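(* For each $n=1,\ldots,N$ and $\gamma>0$, the probability generating function $Y(z)=\mathbb{E}[z^{Y^{(n)}}]$ of the number $Y^{(n)}$ of passenger arrivals within a headway is $$Y(z)=\Phi\left(\frac{-\mu}{\sigma}\right)+e^{\mu\lambda^{(n)}(z-1)+\frac{\sigma^2(\lambda^{(n)}z-\lambda^{(n)})^2}{2}}\left[1-\Phi\left(\frac{-\mu}{\sigma}-\sigma\lambda^{(n)}(z-1)\right)\right],$$ where $\mu=\overline H+\frac{2\gamma T^{(N)}}{\theta\overline F}$ and $\sigma=\frac{2\sqrt{T^{(n)}\gamma}}{\theta}$. When $\gamma=0$, $Y^{(n)}$ is Poisson with mean $\lambda^{(n)}\overline H$ and $Y(z)=\exp[\lambda^{(n)}\overline H(z-1)]$.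
   Context: Constants: nominal scheduled headway $\overline H>0$, route fleet size $\overline F>0$, incident rate $\gamma\ge0$, incident recovery rate $\theta>0$, incident-free travel times $T^{(n)}>0$ from the hub to station $n$ ($n=1,\ldots,N$), and passenger arrival rate $\lambda^{(n)}\ge0$. $\widehat H^{(n)}_{\mathrm{Normal}}$ is normal with mean $\mu$ and standard deviation $\sigma$ (degenerate at $\overline H$ if $\gamma=0$); the headway is $H^{(n)}_{\mathrm{Normal}}=\max\{0,\widehat H^{(n)}_{\mathrm{Normal}}\}$; and conditional on $H^{(n)}_{\mathrm{Normal}}=h$, $Y^{(n)}$ is Poisson with mean $\lambda^{(n)}h$. $\Phi$ is the standard normal cumulative distribution function, extended analytically to complex arguments. *)

theory Defs
  imports "HOL-Probability.Probability" "HOL-Complex_Analysis.Complex_Analysis"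
begin

text \<open>
  The entire function extending the standard normal cumulative distribution function.
  The description is justified by \<open>ex1_normal_cdf_extension\<close> below.
\<close>

definition Phi :: "complex \<Rightarrow> complex" where
  "Phi = (THE F. F holomorphic_on UNIV \<and>
            (\<forall>x::real. F (complex_of_real x) = complex_of_real (cdf std_normal_distribution x)))"

lemma cdf_std_normal_diff:
  assumes der: "\<And>x. (G has_real_derivative std_normal_density x) (at x)" and "a < b"
  shows "cdf std_normal_distribution b - cdf std_normal_distribution a = G b - G a"
proof -
  interpret real_distribution std_normal_distribution
    by (rule real_dist_normal_dist)
  have nn: "(\<integral>\<^sup>+x. ennreal (std_normal_density x) * indicator {a..b} x \<partial>lborel) = ennreal (G b - G a)"
    by (rule nn_integral_FTC_Icc) (use der \<open>a < b\<close> in \<open>auto intro: DERIV_subset\<close>)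
  have le: "G a \<le> G b"
    by (rule DERIV_nonneg_imp_nondecreasing[of a b G]) (use der \<open>a < b\<close> in \<open>auto intro!: exI\<close>)
  have "emeasure std_normal_distribution {a<..b}
      = (\<integral>\<^sup>+x. ennreal (std_normal_density x) * indicator {a<..b} x \<partial>lborel)"
    by (rule emeasure_density) auto
  also have "\<dots> = (\<integral>\<^sup>+x. ennreal (std_normal_density x) * indicator {a..b} x \<partial>lborel)"
    by (rule nn_integral_cong_AE, rule AE_I[where N="{a}"]) (auto split: split_indicator)
  finally have "emeasure std_normal_distribution {a<..b} = ennreal (G b - G a)"
    using nn by simp
  then have "measure std_normal_distribution {a<..b} = G b - G a"
    using le by (simp add: measure_def)
  then show ?thesis
    using cdf_diff_eq[OF \<open>a < b\<close>] by simp
qed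

lemma ex1_normal_cdf_extension:
  "\<exists>!F. F holomorphic_on UNIV \<and>
     (\<forall>x::real. F (complex_of_real x) = complex_of_real (cdf std_normal_distribution x))"
proof (rule ex_ex1I)
  let ?c = "cdf std_normal_distribution"
  let ?g = "\<lambda>z::complex. exp (- (z\<^sup>2 / 2)) / complex_of_real (sqrt (2 * pi))"
  have "?g holomorphic_on UNIV"
    by (intro holomorphic_intros) auto
  then obtain P where P: "\<And>z. (P has_field_derivative ?g z) (at z)"
    using holomorphic_convex_primitive'[of UNIV ?g] by auto
  define F where "F = (\<lambda>z. P z - P 0 + complex_of_real (?c 0))"
  have hol: "F holomorphic_on UNIV"
    unfolding F_def
    by (intro holomorphic_intros)
       (meson P holomorphic_on_def field_differentiable_def has_field_derivative_at_within)
  have vec: "((\<lambda>x. P (complex_of_real x)) has_vector_derivative complex_of_real (std_normal_density x)) (at x)"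
    for x
  proof -
    have "?g (complex_of_real x) = complex_of_real (std_normal_density x)"
      by (simp add: std_normal_density_def flip: exp_of_real)
    then show ?thesis
      using has_vector_derivative_real_field[of P "?g (complex_of_real x)" x UNIV] P[of "complex_of_real x"]
      by simp
  qed
  have der: "((\<lambda>x. Re (P (complex_of_real x))) has_real_derivative std_normal_density x) (at x)" for x
    using bounded_linear.has_vector_derivative[OF bounded_linear_Re vec]
    by (simp add: has_real_derivative_iff_has_vector_derivative)
  have "((\<lambda>x. Im (P (complex_of_real x))) has_real_derivative 0) (at x)" for x
    using bounded_linear.has_vector_derivative[OF bounded_linear_Im vec]
    by (simp add: has_real_derivative_iff_has_vector_derivative)
  then have im: "Im (P (complex_of_real x)) = Im (P 0)" for x
    using DERIV_isconst_all[of "\<lambda>x. Im (P (complex_of_real x))" x 0] by simp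
  have re: "Re (P (complex_of_real x)) - Re (P 0) = ?c x - ?c 0" for x
    using cdf_std_normal_diff[OF der, of x 0] cdf_std_normal_diff[OF der, of 0 x]
    by (cases x "0::real" rule: linorder_cases) auto
  have "F (complex_of_real x) = complex_of_real (?c x)" for x
    using im[of x] re[of x] by (simp add: F_def complex_eq_iff)
  with hol show "\<exists>F. F holomorphic_on UNIV \<and> (\<forall>x::real. F (complex_of_real x) = complex_of_real (?c x))"
    by blast
next
  fix F G
  assume F: "F holomorphic_on UNIV \<and>
      (\<forall>x::real. F (complex_of_real x) = complex_of_real (cdf std_normal_distribution x))"
    and G: "G holomorphic_on UNIV \<and>
      (\<forall>x::real. G (complex_of_real x) = complex_of_real (cdf std_normal_distribution x))"
  have "(0::complex) islimpt range complex_of_real"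
    unfolding islimpt_approachable
  proof (intro allI impI)
    fix e :: real assume "0 < e"
    then show "\<exists>x'\<in>range complex_of_real. x' \<noteq> 0 \<and> dist x' 0 < e"
      by (intro bexI[of _ "complex_of_real (e / 2)"] rangeI) auto
  qed
  then have "F z - G z = 0" for z
    using F G
    by (intro analytic_continuation[of "\<lambda>z. F z - G z" UNIV "range complex_of_real" 0 z])
       (auto intro!: holomorphic_intros)
  then show "F = G" by auto
qed

text \<open>
  The library's \<open>poisson_pmf\<close> is only specified for positive rates, whereas a truncated headway
  (or an arrival rate) can be \<open>0\<close>; the Poisson law with mean \<open>0\<close> is the point mass at \<open>0\<close>.
\<close>

definition poisson_law :: "real \<Rightarrow> nat pmf" where
  "poisson_law m = (if m = 0 then return_pmf 0 else poisson_pmf m)"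

lemma pmf_poisson_law: "0 \<le> m \<Longrightarrow> pmf (poisson_law m) k = m ^ k / fact k * exp (- m)"
  by (cases k) (auto simp: poisson_law_def)

text \<open>
  Conditional on \<open>X = x\<close>, the variable \<open>Y\<close> is Poisson with mean \<open>r * x\<close>: almost surely,
  \<open>P(Y = k | X)\<close> is the Poisson probability of \<open>k\<close> at mean \<open>r * X\<close>.
\<close>

definition conditionally_poisson ::
    "'a measure \<Rightarrow> ('a \<Rightarrow> real) \<Rightarrow> real \<Rightarrow> ('a \<Rightarrow> nat) \<Rightarrow> bool" where
  "conditionally_poisson M X r Y \<longleftrightarrow>
     (\<forall>k. AE \<omega> in M.
        real_cond_exp M (vimage_algebra (space M) X borel) (indicator {\<omega> \<in> space M. Y \<omega> = k}) \<omega>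
          = pmf (poisson_law (r * X \<omega>)) k)"

definition prob_gen_fun :: "'a measure \<Rightarrow> ('a \<Rightarrow> nat) \<Rightarrow> complex \<Rightarrow> complex" where
  "prob_gen_fun M Y z = (LINT \<omega>|M. z ^ Y \<omega>)"

end

theory Submission
  imports Defs
begin

text \<open>
  Where it is finite at every nonnegative real, the generating function of \<open>Y\<close> is a power series
  with infinite radius of convergence, so it is determined by its values on the nonnegative reals.
  At a real \<open>s \<ge> 0\<close> all terms are nonnegative, and conditioning gives the moment generating
  function of the headway at \<open>\<lambda> (s - 1)\<close>. Tilting a normal density by \<open>exp (a x)\<close> only shifts its
  mean by \<open>\<sigma>\<^sup>2 a\<close>, which yields the closed form.
\<close>

section \<open>Conditioning on the headway: Poisson mixtures and exponential moments\<close>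

text \<open>Conditional expectation preserves the integral, so integrating the almost sure identity
  in \<open>conditionally_poisson\<close> over \<open>M\<close> gives the mixed Poisson probability.
  The nonnegative integral lets sums be exchanged later without integrability conditions.\<close>

lemma emeasure_conditionally_poisson:
  assumes "prob_space M" and X: "X \<in> borel_measurable M"
    and Y: "Y \<in> measurable M (count_space UNIV)"
    and cp: "conditionally_poisson M X r Y"
    and nn: "\<And>\<omega>. 0 \<le> r * X \<omega>"
  shows "emeasure M {\<omega> \<in> space M. Y \<omega> = k}
    = (\<integral>\<^sup>+\<omega>. ennreal ((r * X \<omega>) ^ k / fact k * exp (- (r * X \<omega>))) \<partial>M)"
proof -
  interpret prob_space M by fact
  let ?F = "vimage_algebra (space M) X borel"
  let ?A = "{\<omega> \<in> space M. Y \<omega> = k}"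
  have sub: "subalgebra M ?F"
    using X by (auto simp: subalgebra_def sets_vimage_algebra2 measurable_sets)
  interpret finite_measure_subalgebra M ?F
    by unfold_locales (rule sub)
  have A: "?A \<in> sets M"
    using Y by measurable
  have int: "integrable M (indicator ?A :: 'a \<Rightarrow> real)"
    using A by (simp add: emeasure_eq_measure)
  have ce: "AE \<omega> in M. real_cond_exp M ?F (indicator ?A) \<omega> = pmf (poisson_law (r * X \<omega>)) k"
    using cp by (simp add: conditionally_poisson_def)
  have "emeasure M ?A = ennreal (\<integral>\<omega>. indicator ?A \<omega> \<partial>M)"
    using A by (simp add: emeasure_eq_measure)
  also have "\<dots> = ennreal (\<integral>\<omega>. real_cond_exp M ?F (indicator ?A) \<omega> \<partial>M)"
    using real_cond_exp_int(2)[OF int] by simp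
  \<comment> \<open>Nonnegativity almost everywhere comes from \<open>ce\<close>, which identifies
    the conditional expectation with a \<open>pmf\<close>.\<close>
  also have "\<dots> = (\<integral>\<^sup>+\<omega>. ennreal (real_cond_exp M ?F (indicator ?A) \<omega>) \<partial>M)"
    by (rule nn_integral_eq_integral[symmetric])
       (use ce in \<open>auto intro: real_cond_exp_int(1)[OF int] elim!: eventually_mono\<close>)
  also have "\<dots> = (\<integral>\<^sup>+\<omega>. ennreal ((r * X \<omega>) ^ k / fact k * exp (- (r * X \<omega>))) \<partial>M)"
    by (rule nn_integral_cong_AE)
       (use ce in \<open>auto simp: pmf_poisson_law nn elim!: eventually_mono\<close>)
  finally show ?thesis .
qed

text \<open>Splitting over the level sets of \<open>Y\<close> leaves one nonzero term at each point.
  Nonnegative terms allow the exchange of sum and integral, and both sides may be infinite.\<close>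

lemma nn_integral_power_eq_suminf:
  fixes s :: real
  assumes Y: "Y \<in> measurable M (count_space (UNIV :: nat set))" and "0 \<le> s"
  shows "(\<integral>\<^sup>+\<omega>. ennreal (s ^ Y \<omega>) \<partial>M)
    = (\<Sum>k. ennreal (s ^ k) * emeasure M {\<omega> \<in> space M. Y \<omega> = k})"
proof -
  let ?A = "\<lambda>k. {\<omega> \<in> space M. Y \<omega> = k}"
  have A [measurable]: "?A k \<in> sets M" for k
    using Y by measurable
  have "(\<integral>\<^sup>+\<omega>. ennreal (s ^ Y \<omega>) \<partial>M)
      = (\<integral>\<^sup>+\<omega>. (\<Sum>k. ennreal (s ^ k) * indicator (?A k) \<omega>) \<partial>M)"
  proof (rule nn_integral_cong)
    fix \<omega> assume "\<omega> \<in> space M"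
    then show "ennreal (s ^ Y \<omega>) = (\<Sum>k. ennreal (s ^ k) * indicator (?A k) \<omega>)"
      by (subst suminf_finite[of "{Y \<omega>}"]) auto
  qed
  also have "\<dots> = (\<Sum>k. ennreal (s ^ k) * emeasure M (?A k))"
    by (simp add: nn_integral_suminf nn_integral_cmult)
  finally show ?thesis .
qed

text \<open>A Poisson law with mean m has generating function exp(m (s - 1)); here m is
  \<open>r * X \<omega>\<close>, averaged over \<open>M\<close>. Since \<open>s\<close> is
  nonnegative, the sum over \<open>k\<close> may be moved inside the integral.\<close>

lemma nn_integral_power_conditionally_poisson:
  fixes s :: real
  assumes "prob_space M" and X [measurable]: "X \<in> borel_measurable M"
    and Y: "Y \<in> measurable M (count_space UNIV)"
    and cp: "conditionally_poisson M X r Y"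
    and nn: "\<And>\<omega>. 0 \<le> r * X \<omega>" and "0 \<le> s"
  shows "(\<integral>\<^sup>+\<omega>. ennreal (s ^ Y \<omega>) \<partial>M) = (\<integral>\<^sup>+\<omega>. ennreal (exp (r * (s - 1) * X \<omega>)) \<partial>M)"
proof -
  let ?p = "\<lambda>k \<omega>. (r * X \<omega>) ^ k / fact k * exp (- (r * X \<omega>))"
  have sums: "(\<lambda>k. s ^ k * ?p k \<omega>) sums exp (r * (s - 1) * X \<omega>)" for \<omega>
  proof -
    \<comment> \<open>The exponential series at \<open>s * (r * X \<omega>)\<close>, multiplied by
      the Poisson normalization.\<close>
    have "(\<lambda>k. (s * (r * X \<omega>)) ^ k /\<^sub>R fact k * exp (- (r * X \<omega>)))
        sums (exp (s * (r * X \<omega>)) * exp (- (r * X \<omega>)))"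
      by (intro sums_mult2 exp_converges)
    then show ?thesis
      by (simp add: power_mult_distrib divide_inverse algebra_simps flip: exp_add)
  qed
  have "(\<integral>\<^sup>+\<omega>. ennreal (s ^ Y \<omega>) \<partial>M) = (\<Sum>k. ennreal (s ^ k) * (\<integral>\<^sup>+\<omega>. ennreal (?p k \<omega>) \<partial>M))"
    using nn_integral_power_eq_suminf[OF Y \<open>0 \<le> s\<close>]
    by (simp only: emeasure_conditionally_poisson[OF assms(1) X Y cp nn])
  also have "\<dots> = (\<Sum>k. \<integral>\<^sup>+\<omega>. ennreal (s ^ k * ?p k \<omega>) \<partial>M)"
  proof (intro arg_cong[where f=suminf] ext)
    fix k
    have "ennreal (s ^ k * ?p k \<omega>) = ennreal (s ^ k) * ennreal (?p k \<omega>)" for \<omega>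
      using \<open>0 \<le> s\<close> by (intro ennreal_mult') simp
    then show "ennreal (s ^ k) * (\<integral>\<^sup>+\<omega>. ennreal (?p k \<omega>) \<partial>M) = (\<integral>\<^sup>+\<omega>. ennreal (s ^ k * ?p k \<omega>) \<partial>M)"
      by (simp only: nn_integral_cmult) (subst nn_integral_cmult; measurable)
  qed
  also have "\<dots> = (\<integral>\<^sup>+\<omega>. (\<Sum>k. ennreal (s ^ k * ?p k \<omega>)) \<partial>M)"
    by (rule nn_integral_suminf[symmetric]) measurable
  also have "\<dots> = (\<integral>\<^sup>+\<omega>. ennreal (exp (r * (s - 1) * X \<omega>)) \<partial>M)"
    by (intro nn_integral_cong suminf_ennreal_eq sums) (use \<open>0 \<le> s\<close> nn in auto)
  finally show ?thesis .
qed

section \<open>Identification of a generating function by analytic continuation\<close>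

text \<open>The identity theorem applies because both sides are entire and agree on a half-line.
  Keeping the real \<open>g\<close> apart from \<open>G\<close> means that only nonnegative
  integrals have to be computed; complex arguments enter through \<open>G\<close> alone.\<close>

lemma prob_gen_fun_eqI:
  fixes g :: "real \<Rightarrow> real"
  assumes "prob_space M"
    and Y [measurable]: "Y \<in> measurable M (count_space UNIV)"
    and g: "\<And>s. 0 \<le> s \<Longrightarrow> (\<integral>\<^sup>+\<omega>. ennreal (s ^ Y \<omega>) \<partial>M) = ennreal (g s)"
    and G: "G holomorphic_on UNIV"
    and gG: "\<And>s. 0 \<le> s \<Longrightarrow> 0 \<le> g s \<and> G (complex_of_real s) = complex_of_real (g s)"
  shows "integrable M (\<lambda>\<omega>. z ^ Y \<omega>)" and "prob_gen_fun M Y z = G z"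
proof -
  interpret prob_space M by fact
  let ?A = "\<lambda>k. {\<omega> \<in> space M. Y \<omega> = k}"
  \<comment> \<open>The norm of the integrand is a power of \<open>norm z\<close>, so
    \<open>g\<close> at \<open>norm z\<close> bounds its integral.\<close>
  show int: "integrable M (\<lambda>\<omega>. z ^ Y \<omega>)" for z :: complex
    by (rule integrableI_bounded) (auto simp: g norm_power)
  \<comment> \<open>Writing \<open>z - 0\<close> displays the centre of the power series, as needed
    by \<open>power_series_holomorphic\<close>.\<close>
  have series: "(\<lambda>k. complex_of_real (prob (?A k)) * (z - 0) ^ k) sums prob_gen_fun M Y z" for z
  proof -
    let ?f = "\<lambda>k \<omega>. indicator (?A k) \<omega> *\<^sub>R z ^ k"
    have f: "integrable M (?f k)" for k
      by (intro integrable_scaleR_left integrable_real_indicator) (auto simp: emeasure_eq_measure)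
    have single: "(\<lambda>k. ?f k \<omega>) sums (z ^ Y \<omega>)" if "\<omega> \<in> space M" for \<omega>
    proof -
      have "(\<lambda>k. ?f k \<omega>) = (\<lambda>k. if k = Y \<omega> then z ^ k else 0)"
        using that by (auto simp: indicator_def)
      then show ?thesis
        using sums_single[of "Y \<omega>" "\<lambda>k. z ^ k"] by simp
    qed
    \<comment> \<open>Absolute convergence at \<open>z\<close>: the sum of the norms is the real
      generating function at \<open>norm z\<close>, which is finite.\<close>
    have "(\<Sum>k. ennreal (norm z ^ k * prob (?A k))) = ennreal (g (norm z))"
      using nn_integral_power_eq_suminf[OF Y norm_ge_zero[of z]] g[of "norm z"]
      by (simp add: emeasure_eq_measure ennreal_mult')
    then have "summable (\<lambda>k. norm z ^ k * prob (?A k))"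
      by (intro summable_suminf_not_top) auto
    then have "summable (\<lambda>k. \<integral>\<omega>. norm (?f k \<omega>) \<partial>M)"
      by (simp add: norm_power mult.commute)
    then have "(\<lambda>k. \<integral>\<omega>. ?f k \<omega> \<partial>M) sums (\<integral>\<omega>. (\<Sum>k. ?f k \<omega>) \<partial>M)"
    proof (intro sums_integral f AE_I2)
      fix \<omega> assume "\<omega> \<in> space M"
      then show "summable (\<lambda>k. norm (?f k \<omega>))"
        by (intro summable_finite[of "{Y \<omega>}"]) auto
    qed
    moreover have "(\<integral>\<omega>. (\<Sum>k. ?f k \<omega>) \<partial>M) = prob_gen_fun M Y z"
      unfolding prob_gen_fun_def
      by (intro Bochner_Integration.integral_cong refl sums_unique[symmetric] single)
    moreover have "(\<integral>\<omega>. ?f k \<omega> \<partial>M) = complex_of_real (prob (?A k)) * (z - 0) ^ k" for k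
      by (simp add: scaleR_conv_of_real)
    ultimately show ?thesis by simp
  qed
  have hol: "prob_gen_fun M Y holomorphic_on UNIV"
  proof -
    \<comment> \<open>Power series are handled on balls; radius \<open>norm w + 1\<close> ensures
      that \<open>w\<close> is an interior point.\<close>
    have "prob_gen_fun M Y holomorphic_on ball 0 (norm w + 1)" for w
      by (rule power_series_holomorphic[OF series])
    then have "prob_gen_fun M Y field_differentiable at w" for w
      by (rule holomorphic_on_imp_differentiable_at[of _ "ball 0 (norm w + 1)"]) auto
    then show ?thesis
      by (auto simp: holomorphic_on_def)
  qed
  have real: "prob_gen_fun M Y (complex_of_real s) = G (complex_of_real s)" if "0 \<le> s" for s
  proof -
    have "prob_gen_fun M Y (complex_of_real s) = complex_of_real (\<integral>\<omega>. s ^ Y \<omega> \<partial>M)"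
      unfolding prob_gen_fun_def by (simp flip: integral_complex_of_real)
    also have "(\<integral>\<omega>. s ^ Y \<omega> \<partial>M) = g s"
      using that gG[OF that] by (intro integral_eq_nn_integral[THEN trans]) (auto simp: g)
    finally show ?thesis using gG[OF that] by simp
  qed
  \<comment> \<open>The endpoint 0 of the half-line is still an accumulation point, and it lies
    inside the domain \<open>UNIV\<close>, which is all the identity theorem requires.\<close>
  have lim: "(0::complex) islimpt complex_of_real ` {0..}"
    unfolding islimpt_approachable
  proof (intro allI impI)
    fix e :: real assume "0 < e"
    then show "\<exists>x'\<in>complex_of_real ` {0..}. x' \<noteq> 0 \<and> dist x' 0 < e"
      by (intro bexI[of _ "complex_of_real (e / 2)"] imageI) auto
  qed
  have "prob_gen_fun M Y z - G z = 0"
    by (rule analytic_continuation[of "\<lambda>z. prob_gen_fun M Y z - G z" UNIV "complex_of_real ` {0..}" 0 z])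
       (use lim real in \<open>auto intro!: holomorphic_intros hol G\<close>)
  then show "prob_gen_fun M Y z = G z" by simp
qed

section \<open>Exponential moments of the truncated normal headway\<close>

text \<open>Standardization: substituting \<open>m + \<sigma> * x\<close> turns the threshold 0 into
  \<open>- m / \<sigma>\<close>.\<close>

lemma nn_integral_normal_density_indicator:
  assumes "0 < \<sigma>"
  shows "(\<integral>\<^sup>+x. ennreal (normal_density m \<sigma> x) * indicator {..0} x \<partial>lborel)
      = ennreal (cdf std_normal_distribution (- m / \<sigma>))" (is ?le)
    and "(\<integral>\<^sup>+x. ennreal (normal_density m \<sigma> x) * indicator {0<..} x \<partial>lborel)
      = ennreal (1 - cdf std_normal_distribution (- m / \<sigma>))" (is ?gt)
proof -
  interpret real_distribution std_normal_distribution
    by (rule real_dist_normal_dist)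
  \<comment> \<open>The Jacobian \<open>\<sigma>\<close> of the substitution cancels the factor in
    the normalizing constant.\<close>
  have dens: "\<sigma> * normal_density m \<sigma> (m + \<sigma> * x) = std_normal_density x" for x
    using \<open>0 < \<sigma>\<close> by (simp add: normal_density_def std_normal_density_def real_sqrt_mult power_mult_distrib)
  have *: "(\<integral>\<^sup>+x. ennreal (normal_density m \<sigma> x) * indicator A x \<partial>lborel)
      = emeasure std_normal_distribution {x. m + \<sigma> * x \<in> A}" if [measurable]: "A \<in> sets borel" for A
  proof -
    have "(\<integral>\<^sup>+x. ennreal (normal_density m \<sigma> x) * indicator A x \<partial>lborel)
       = (\<integral>\<^sup>+x. ennreal \<sigma> * (ennreal (normal_density m \<sigma> (m + \<sigma> * x)) * indicator A (m + \<sigma> * x)) \<partial>lborel)"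
      using \<open>0 < \<sigma>\<close> by (subst nn_integral_real_affine[where c=\<sigma> and t=m]) (auto simp: nn_integral_cmult)
    also have "\<dots> = (\<integral>\<^sup>+x. ennreal (std_normal_density x) * indicator {x. m + \<sigma> * x \<in> A} x \<partial>lborel)"
      using \<open>0 < \<sigma>\<close>
      by (intro nn_integral_cong) (simp add: indicator_def flip: dens ennreal_mult)
    also have "\<dots> = emeasure std_normal_distribution {x. m + \<sigma> * x \<in> A}"
      by (rule emeasure_density[symmetric]) measurable
    finally show ?thesis .
  qed
  have "{x. m + \<sigma> * x \<in> {..0}} = {..- m / \<sigma>}"
    using \<open>0 < \<sigma>\<close> by (auto simp: field_simps)
  then show ?le
    using *[of "{..0}"] by (simp add: cdf_def emeasure_eq_measure)
  have "{x. m + \<sigma> * x \<in> {0<..}} = space std_normal_distribution - {..- m / \<sigma>}"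
    using \<open>0 < \<sigma>\<close> by (auto simp: field_simps)
  then show ?gt
    using *[of "{0<..}"] prob_compl[of "{..- m / \<sigma>}"] by (simp add: cdf_def emeasure_eq_measure)
qed

text \<open>Completing the square in the exponent. The standard deviation is unchanged, so the
  normalizing constants on both sides agree.\<close>

lemma exp_mult_normal_density:
  assumes "0 < \<sigma>"
  shows "exp (a * x) * normal_density \<mu> \<sigma> x
    = exp (\<mu> * a + \<sigma>\<^sup>2 * a\<^sup>2 / 2) * normal_density (\<mu> + \<sigma>\<^sup>2 * a) \<sigma> x"
proof -
  have "a * x - (x - \<mu>)\<^sup>2 / (2 * \<sigma>\<^sup>2)
      = \<mu> * a + \<sigma>\<^sup>2 * a\<^sup>2 / 2 - (x - (\<mu> + \<sigma>\<^sup>2 * a))\<^sup>2 / (2 * \<sigma>\<^sup>2)"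
    using assms by (simp add: field_simps power2_eq_square)
  then show ?thesis
    by (simp add: normal_density_def flip: exp_add)
qed

text \<open>Where the normal variable is at most 0 the integrand is 1, which gives the first
  summand. On the positive half-line the exponential tilts the density, leaving the upper tail of a
  normal law with shifted mean.\<close>

lemma nn_integral_exp_max_normal:
  assumes D: "distributed M lborel X (normal_density \<mu> \<sigma>)" and "0 < \<sigma>"
  shows "(\<integral>\<^sup>+\<omega>. ennreal (exp (a * max 0 (X \<omega>))) \<partial>M)
    = ennreal (cdf std_normal_distribution (- \<mu> / \<sigma>)
        + exp (\<mu> * a + \<sigma>\<^sup>2 * a\<^sup>2 / 2) * (1 - cdf std_normal_distribution (- \<mu> / \<sigma> - \<sigma> * a)))"
proof -
  interpret real_distribution std_normal_distribution
    by (rule real_dist_normal_dist)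
  let ?c = "exp (\<mu> * a + \<sigma>\<^sup>2 * a\<^sup>2 / 2)"
  have le1: "cdf std_normal_distribution x \<le> 1" for x
    by (simp add: cdf_def)
  have "(\<integral>\<^sup>+\<omega>. ennreal (exp (a * max 0 (X \<omega>))) \<partial>M)
      = (\<integral>\<^sup>+x. ennreal (normal_density \<mu> \<sigma> x) * ennreal (exp (a * max 0 x)) \<partial>lborel)"
    by (rule distributed_nn_integral[OF D, symmetric]) measurable
  also have "\<dots> = (\<integral>\<^sup>+x. ennreal (normal_density \<mu> \<sigma> x) * indicator {..0} x
      + ennreal ?c * (ennreal (normal_density (\<mu> + \<sigma>\<^sup>2 * a) \<sigma> x) * indicator {0<..} x) \<partial>lborel)"
  proof (intro nn_integral_cong)
    fix x :: real
    show "ennreal (normal_density \<mu> \<sigma> x) * ennreal (exp (a * max 0 x))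
      = ennreal (normal_density \<mu> \<sigma> x) * indicator {..0} x
        + ennreal ?c * (ennreal (normal_density (\<mu> + \<sigma>\<^sup>2 * a) \<sigma> x) * indicator {0<..} x)"
      using exp_mult_normal_density[OF \<open>0 < \<sigma>\<close>, of a x \<mu>]
      by (cases "x \<le> 0") (auto simp: max_def mult.commute simp flip: ennreal_mult)
  qed
  also have "\<dots> = ennreal (cdf std_normal_distribution (- \<mu> / \<sigma>))
      + ennreal ?c * ennreal (1 - cdf std_normal_distribution (- (\<mu> + \<sigma>\<^sup>2 * a) / \<sigma>))"
    by (simp add: nn_integral_add nn_integral_cmult nn_integral_normal_density_indicator[OF \<open>0 < \<sigma>\<close>])
  \<comment> \<open>Standardizing the shifted mean yields the displaced argument of the closed
    form.\<close>
  also have "- (\<mu> + \<sigma>\<^sup>2 * a) / \<sigma> = - \<mu> / \<sigma> - \<sigma> * a"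
    using \<open>0 < \<sigma>\<close> by (simp add: field_simps power2_eq_square)
  finally show ?thesis
    using le1 by (simp add: cdf_nonneg ennreal_plus ennreal_mult)
qed

section \<open>The closed forms for positive and zero incident rate\<close>

lemma holomorphic_Phi: "Phi holomorphic_on UNIV"
  and Phi_of_real: "Phi (complex_of_real x) = complex_of_real (cdf std_normal_distribution x)"
  using theI'[OF ex1_normal_cdf_extension] unfolding Phi_def by auto

theorem proposition11:
  fixes M :: "'a measure"
    and Hbar Fbar \<gamma> \<theta> \<mu> \<sigma> :: real
    and N n :: nat
    and T lam :: "nat \<Rightarrow> real"
    and Hhat H :: "nat \<Rightarrow> 'a \<Rightarrow> real"
    and Y :: "nat \<Rightarrow> 'a \<Rightarrow> nat"
  assumes "prob_space M"
    and "Hbar > 0" "Fbar > 0" "\<gamma> \<ge> 0" "\<theta> > 0"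
    and "\<And>i. i \<in> {1..N} \<Longrightarrow> T i > 0"
    and "\<And>i. i \<in> {1..N} \<Longrightarrow> lam i \<ge> 0"
    and "n \<in> {1..N}"
    and "\<mu> = Hbar + 2 * \<gamma> * T N / (\<theta> * Fbar)"
    and "\<sigma> = 2 * sqrt (T n * \<gamma>) / \<theta>"
    and "Hhat n \<in> borel_measurable M"
    and "\<gamma> > 0 \<Longrightarrow> distributed M lborel (Hhat n) (normal_density \<mu> \<sigma>)"
    and "\<gamma> = 0 \<Longrightarrow> distr M borel (Hhat n) = return borel Hbar"
    and "H n = (\<lambda>\<omega>. max 0 (Hhat n \<omega>))"
    and "Y n \<in> measurable M (count_space UNIV)"
    and "conditionally_poisson M (H n) (lam n) (Y n)"
  shows "(\<gamma> > 0 \<longrightarrow>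
           (\<forall>z::complex.
              integrable M (\<lambda>\<omega>. z ^ Y n \<omega>) \<and>
              prob_gen_fun M (Y n) z =
                Phi (of_real (- \<mu> / \<sigma>))
                + exp (of_real (\<mu> * lam n) * (z - 1)
                       + of_real (\<sigma>\<^sup>2) * (of_real (lam n) * z - of_real (lam n))\<^sup>2 / 2)
                  * (1 - Phi (of_real (- \<mu> / \<sigma>) - of_real (\<sigma> * lam n) * (z - 1))))) \<and>
         (\<gamma> = 0 \<longrightarrow>
           distr M (count_space UNIV) (Y n) = measure_pmf (poisson_law (lam n * Hbar)) \<and>
           (\<forall>z::complex.
              integrable M (\<lambda>\<omega>. z ^ Y n \<omega>) \<and>
              prob_gen_fun M (Y n) z = exp (of_real (lam n * Hbar) * (z - 1))))"
proof (intro conjI impI)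
  interpret prob_space M by fact
  let ?c = "cdf std_normal_distribution"
  have lam: "0 \<le> lam n"
    using assms(7,8) by auto
  \<comment> \<open>Truncation at 0 makes the Poisson means nonnegative at every point, not merely
    almost surely.\<close>
  have nn: "0 \<le> lam n * H n \<omega>" for \<omega>
    using lam by (simp add: assms(14))
  have H: "H n \<in> borel_measurable M"
    using assms(11) by (simp add: assms(14))
  note Y = assms(15)
  note pgf = nn_integral_power_conditionally_poisson[OF assms(1) H Y assms(16) nn]
  {
    assume "\<gamma> > 0"
    then have \<sigma>: "0 < \<sigma>"
      using assms(5,6,8,10) by simp
    \<comment> \<open>\<open>?g\<close> is the truncated normal moment at
      \<open>lam n * (s - 1)\<close>; \<open>?G\<close> is its entire extension, with
      \<open>Phi\<close> in place of the real distribution function.\<close>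
    let ?g = "\<lambda>s. ?c (- \<mu> / \<sigma>) + exp (\<mu> * (lam n * (s - 1)) + \<sigma>\<^sup>2 * (lam n * (s - 1))\<^sup>2 / 2)
        * (1 - ?c (- \<mu> / \<sigma> - \<sigma> * (lam n * (s - 1))))"
    let ?G = "\<lambda>z. Phi (of_real (- \<mu> / \<sigma>))
                + exp (of_real (\<mu> * lam n) * (z - 1)
                       + of_real (\<sigma>\<^sup>2) * (of_real (lam n) * z - of_real (lam n))\<^sup>2 / 2)
                  * (1 - Phi (of_real (- \<mu> / \<sigma>) - of_real (\<sigma> * lam n) * (z - 1)))"
    have g: "(\<integral>\<^sup>+\<omega>. ennreal (s ^ Y n \<omega>) \<partial>M) = ennreal (?g s)" if "0 \<le> s" for s
      using pgf[OF that] nn_integral_exp_max_normal[OF assms(12)[OF \<open>\<gamma> > 0\<close>] \<sigma>, of "lam n * (s - 1)"]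
      by (simp add: assms(14))
    have G: "?G holomorphic_on UNIV"
      by (intro holomorphic_intros holomorphic_on_compose_gen[OF _ holomorphic_Phi, unfolded o_def]) auto
    have gG: "0 \<le> ?g s \<and> ?G (complex_of_real s) = complex_of_real (?g s)" for s
    proof
      interpret S: real_distribution std_normal_distribution
        by (rule real_dist_normal_dist)
      show "0 \<le> ?g s"
        by (intro add_nonneg_nonneg mult_nonneg_nonneg S.cdf_nonneg) (auto simp: cdf_def)
      \<comment> \<open>At real \<open>s\<close> the argument of \<open>Phi\<close> is real; this
        form lets \<open>Phi_of_real\<close> rewrite it.\<close>
      have arg: "of_real (- \<mu> / \<sigma>) - of_real (\<sigma> * lam n) * (complex_of_real s - 1)
          = complex_of_real (- \<mu> / \<sigma> - \<sigma> * (lam n * (s - 1)))"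
        by simp
      show "?G (complex_of_real s) = complex_of_real (?g s)"
        unfolding arg Phi_of_real by (simp add: algebra_simps flip: exp_of_real)
    qed
    show "\<forall>z. integrable M (\<lambda>\<omega>. z ^ Y n \<omega>) \<and> prob_gen_fun M (Y n) z = ?G z"
      using prob_gen_fun_eqI[OF assms(1) Y g G gG] by blast
  }
  assume "\<gamma> = 0"
  then have "AE x in distr M borel (Hhat n). x = Hbar"
    unfolding assms(13)[OF \<open>\<gamma> = 0\<close>] by (subst AE_return) auto
  \<comment> \<open>Because \<open>Hbar\<close> is positive, truncation leaves the degenerate
    headway unchanged.\<close>
  then have AE_H: "AE \<omega> in M. H n \<omega> = Hbar"
    using assms(2,11) by (subst (asm) AE_distr_iff) (auto simp: assms(14) elim!: eventually_mono)
  \<comment> \<open>A law on the naturals is determined by its atoms, and with a constant headway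
    each mixed Poisson atom is an integral of a constant over a probability space.\<close>
  show "distr M (count_space UNIV) (Y n) = measure_pmf (poisson_law (lam n * Hbar))"
  proof (rule measure_eqI_countable[where A=UNIV])
    fix k
    have "emeasure (distr M (count_space UNIV) (Y n)) {k} = emeasure M {\<omega> \<in> space M. Y n \<omega> = k}"
      using Y by (simp add: emeasure_distr vimage_def Int_def conj_commute)
    also have "\<dots> = (\<integral>\<^sup>+\<omega>. ennreal ((lam n * Hbar) ^ k / fact k * exp (- (lam n * Hbar))) \<partial>M)"
      unfolding emeasure_conditionally_poisson[OF assms(1) H Y assms(16) nn]
      by (rule nn_integral_cong_AE) (use AE_H in \<open>auto elim!: eventually_mono\<close>)
    also have "\<dots> = emeasure (measure_pmf (poisson_law (lam n * Hbar))) {k}"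
      using lam assms(2) by (simp add: emeasure_pmf_single pmf_poisson_law emeasure_space_1)
    finally show "emeasure (distr M (count_space UNIV) (Y n)) {k}
        = emeasure (measure_pmf (poisson_law (lam n * Hbar))) {k}" .
  qed auto
  \<comment> \<open>The exponential moment of a constant headway, computed by the same conditioning
    as for positive \<open>\<gamma>\<close>.\<close>
  have g: "(\<integral>\<^sup>+\<omega>. ennreal (s ^ Y n \<omega>) \<partial>M) = ennreal (exp (lam n * Hbar * (s - 1)))"
    if "0 \<le> s" for s
  proof -
    have "(\<integral>\<^sup>+\<omega>. ennreal (exp (lam n * (s - 1) * H n \<omega>)) \<partial>M)
        = (\<integral>\<^sup>+\<omega>. ennreal (exp (lam n * Hbar * (s - 1))) \<partial>M)"
      by (rule nn_integral_cong_AE) (use AE_H in \<open>auto simp: mult_ac elim!: eventually_mono\<close>)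
    then show ?thesis
      using pgf[OF that] by (simp add: emeasure_space_1)
  qed
  have G: "(\<lambda>z. exp (of_real (lam n * Hbar) * (z - 1))) holomorphic_on UNIV"
    by (intro holomorphic_intros)
  have gG: "0 \<le> exp (lam n * Hbar * (s - 1)) \<and> exp (of_real (lam n * Hbar) * (complex_of_real s - 1))
      = complex_of_real (exp (lam n * Hbar * (s - 1)))" for s
    by (simp flip: exp_of_real)
  show "\<forall>z. integrable M (\<lambda>\<omega>. z ^ Y n \<omega>)
      \<and> prob_gen_fun M (Y n) z = exp (of_real (lam n * Hbar) * (z - 1))"
    using prob_gen_fun_eqI[OF assms(1) Y g G gG] by blast
qed

end
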